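(* Let $r\in\mathbb{N}$, let $\overrightarrow{\Phi}=(\phi_1,\dots,\phi_r)$ be a tuple of Orlicz functions, and let $\lambda>0$. For every $f\in L^{\overrightarrow{\Phi}}([-1,1]^r)$ and every $n\in\mathbb{N}$, $$I^{\overrightarrow{\Phi}}[\lambda K_nf]\le I^{\overrightarrow{\Phi}}[\lambda' f],\qquad\text{where }\lambda'=\frac{\lambda}{(\Psi_\rho(2))^{r}}>0.$$
   Context: Write $\mathcal{J}=[-1,1]^r$, and let $M(\mathcal{J})$ be the set of measurable real functions on $\mathcal{J}$. Orlicz function: a convex, non-decreasing, left-continuous function $\phi:[0,\infty)\to[0,\infty]$ with $\phi(0)=0$ and $\lim_{u\to\infty}\phi(u)=\infty$ (with the convention $\phi(\infty)=\infty$). Mixed norm Orlicz space: for a tuple $\overrightarrow{\Phi}=(\phi_1,\dots,\phi_r)$ of Orlicz functions and $f\in M(\mathcal{J})$, $$I^{\overrightarrow{\Phi}}[f]=\int_{-1}^{1}\phi_r\left(\int_{-1}^{1}\phi_{r-1}\cdots\left(\int_{-1}^{1}\phi_1(|f(x_1,\dots,x_r)|)\,dx_1\right)\cdots dx_{r-1}\right)dx_r,$$ and $L^{\overrightarrow{\Phi}}(\mathcal{J})=\{f\in M(\mathcal{J}): I^{\overrightarrow{\Phi}}[\lambda f]<\infty\text{ for some }\lambda>0\}$. Activation function: $\rho:\mathbb{R}\to\mathbb{R}$ is a fixed non-decreasing sigmoidal function, i.e. $\lim_{x\to-\infty}\rho(x)=0$ and $\lim_{x\to\infty}\rho(x)=1$.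 Its univariate density function is $\Psi_\rho(x)=\frac12\big(\rho(x+1)-\rho(x-1)\big)$, $x\in\mathbb{R}$, and its multivariate density function is $\Psi_\rho(\mathbf{x})=\Psi_\rho(x_1)\cdots\Psi_\rho(x_r)$ for $\mathbf{x}=(x_1,\dots,x_r)\in\mathbb{R}^r$. In $\lambda'$, $\Psi_\rho(2)$ is the univariate density at $2$. Standing assumptions on $\Psi_\rho$: $\Psi_\rho(x)=\mathcal{O}(|x|^{-\eta})$ as $x\to\pm\infty$ for some $\eta>1$; $\int_{\mathbb{R}}\Psi_\rho(t)\,dt=1$; $\sum_{k\in\mathbb{Z}}\Psi_\rho(x-k)=1$ for every $x\in\mathbb{R}$, the series converging uniformly on compact sets; and, for all $n\in\mathbb{N}$ and $x\in[-1,1]$, $\sum_{k=-n}^{n-1}\Psi_\rho(nx-k)\ge\Psi_\rho(2)>0$. Multivariate Kantorovich-type neural network operators: for integrable $f:\mathcal{J}\to\mathbb{R}$, $n\in\mathbb{N}$ and $\mathbf{x}\in\mathcal{J}$, $$K_nf(\mathbf{x})=K_n(f,\mathbf{x})=\frac{\sum_{\mathbf{k}\in\{-n,\dots,n-1\}^r}\left(n^r\int_{I_{\mathbf{k},n}}f(\mathbf{t})\,d\mathbf{t}\right)\Psi_\rho(n\mathbf{x}-\mathbf{k})}{\sum_{\mathbf{k}\in\{-n,\dots,n-1\}^r}\Psi_\rho(n\mathbf{x}-\mathbf{k})},\qquad I_{\mathbf{k},n}=\prod_{j=1}^{r}\left[\frac{k_j}{n},\frac{k_j+1}{n}\right].$$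 *)

theory Defs
  imports "HOL-Analysis.Analysis" "HOL-Library.Landau_Symbols"
begin

(* Points of R^r are functions nat => real that are extensional on {1..r}, so that r is an
   ordinary number and the coordinates keep the order needed for iterated integration. *)

definition cube :: "nat \<Rightarrow> (nat \<Rightarrow> real) set" where
  "cube r = {1..r} \<rightarrow>\<^sub>E {-1..1}"

(* Lebesgue measure on R^r: the product of Borel measures has to be completed. *)
definition lebesgue_dim :: "nat \<Rightarrow> (nat \<Rightarrow> real) measure" where
  "lebesgue_dim r = completion (Pi\<^sub>M {1..r} (\<lambda>_. lborel))"

definition measurable_on_cube :: "nat \<Rightarrow> ((nat \<Rightarrow> real) \<Rightarrow> real) set" where
  "measurable_on_cube r = borel_measurable (restrict_space (lebesgue_dim r) (cube r))"

(* Only the values of phi on [0, \<infinity>) matter. *)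
definition orlicz_function :: "(real \<Rightarrow> ennreal) \<Rightarrow> bool" where
  "orlicz_function \<phi> \<longleftrightarrow>
     (\<forall>u\<ge>0. \<forall>v\<ge>0. \<forall>t\<in>{0..1}.
        \<phi> ((1 - t) * u + t * v) \<le> ennreal (1 - t) * \<phi> u + ennreal t * \<phi> v) \<and>
     mono_on {0..} \<phi> \<and>
     (\<forall>u>0. (\<phi> \<longlongrightarrow> \<phi> u) (at_left u)) \<and>
     \<phi> 0 = 0 \<and>
     (\<phi> \<longlongrightarrow> \<infinity>) at_top"

(* The convention phi(\<infinity>) = \<infinity>. *)
definition orlicz_ext :: "(real \<Rightarrow> ennreal) \<Rightarrow> ennreal \<Rightarrow> ennreal" where
  "orlicz_ext \<phi> u = (if u = \<infinity> then \<infinity> else \<phi> (enn2real u))"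

(* The m innermost integrations of the mixed modular: coordinates 1, ..., m are integrated
   out and the remaining coordinates are read from x. *)
primrec partial_modular ::
  "(nat \<Rightarrow> real \<Rightarrow> ennreal) \<Rightarrow> ((nat \<Rightarrow> real) \<Rightarrow> real) \<Rightarrow> nat \<Rightarrow> (nat \<Rightarrow> real) \<Rightarrow> ennreal" where
  "partial_modular \<Phi> f 0 x = ennreal \<bar>f x\<bar>"
| "partial_modular \<Phi> f (Suc m) x =
     (\<integral>\<^sup>+ t\<in>{-1..1}. orlicz_ext (\<Phi> (Suc m)) (partial_modular \<Phi> f m (x(Suc m := t))) \<partial>lebesgue)"

(* Starting from the everywhere undefined point, f is evaluated at points of cube r only. *)
definition mixed_modular ::
  "nat \<Rightarrow> (nat \<Rightarrow> real \<Rightarrow> ennreal) \<Rightarrow> ((nat \<Rightarrow> real) \<Rightarrow> real) \<Rightarrow> ennreal" where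
  "mixed_modular r \<Phi> f = partial_modular \<Phi> f r (\<lambda>_. undefined)"

definition mixed_orlicz_space ::
  "nat \<Rightarrow> (nat \<Rightarrow> real \<Rightarrow> ennreal) \<Rightarrow> ((nat \<Rightarrow> real) \<Rightarrow> real) set" where
  "mixed_orlicz_space r \<Phi> =
     {f \<in> measurable_on_cube r. \<exists>c>0. mixed_modular r \<Phi> (\<lambda>x. c * f x) < \<infinity>}"

definition sigmoidal :: "(real \<Rightarrow> real) \<Rightarrow> bool" where
  "sigmoidal \<rho> \<longleftrightarrow> (\<rho> \<longlongrightarrow> 0) at_bot \<and> (\<rho> \<longlongrightarrow> 1) at_top"

definition Psi :: "(real \<Rightarrow> real) \<Rightarrow> real \<Rightarrow> real" where
  "Psi \<rho> x = (\<rho> (x + 1) - \<rho> (x - 1)) / 2"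

definition Psi_dim :: "(real \<Rightarrow> real) \<Rightarrow> nat \<Rightarrow> (nat \<Rightarrow> real) \<Rightarrow> real" where
  "Psi_dim \<rho> r x = (\<Prod>j\<in>{1..r}. Psi \<rho> (x j))"

definition grid_indices :: "nat \<Rightarrow> nat \<Rightarrow> (nat \<Rightarrow> int) set" where
  "grid_indices r n = {1..r} \<rightarrow>\<^sub>E {- int n..int n - 1}"

definition grid_cell :: "nat \<Rightarrow> nat \<Rightarrow> (nat \<Rightarrow> int) \<Rightarrow> (nat \<Rightarrow> real) set" where
  "grid_cell r n k =
     (\<Pi>\<^sub>E j\<in>{1..r}. {real_of_int (k j) / real n..(real_of_int (k j) + 1) / real n})"

definition kantorovich_op ::
  "(real \<Rightarrow> real) \<Rightarrow> nat \<Rightarrow> nat \<Rightarrow> ((nat \<Rightarrow> real) \<Rightarrow> real) \<Rightarrow> (nat \<Rightarrow> real) \<Rightarrow> real" where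
  "kantorovich_op \<rho> r n f x =
     (\<Sum>k\<in>grid_indices r n.
        (real n ^ r * (LINT t:grid_cell r n k|lebesgue_dim r. f t)) *
        Psi_dim \<rho> r (\<lambda>j. real n * x j - real_of_int (k j))) /
     (\<Sum>k\<in>grid_indices r n. Psi_dim \<rho> r (\<lambda>j. real n * x j - real_of_int (k j)))"

end

theory Submission
  imports Defs
begin

text \<open>For a single coordinate put
  \<open>\<kappa>(s, t) = n \<Sum>k \<Psi>(n s - k) 1[t \<in> [k/n, (k+1)/n]]\<close>, the sum being over \<open>-n \<le> k < n\<close>.
  Because the translates of \<open>\<Psi>\<close> sum to 1 and \<open>\<Psi>\<close> has integral 1, this kernel is substochastic in
  each of its two arguments. The denominator of the operator is at least \<open>\<Psi>(2)^r\<close>, so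
  \<open>\<lambda> |K_n f|\<close> is dominated by the average of \<open>\<lambda>' |f|\<close> against the product of these kernels.
  Jensen's inequality for the Orlicz functions, applied one coordinate at a time, moves the average
  outside the iterated integrals, where it can only decrease the mixed modular.\<close>

section \<open>Orlicz functions: affine minorants, measurability and Jensen's inequality\<close>

text \<open>An affine function below \<open>\<phi>\<close> whose value at \<open>u\<close> is at least \<open>c\<close>: by left continuity \<open>\<phi>\<close> already
  exceeds \<open>c\<close> at some \<open>u2 < u\<close>, and the line through \<open>(u2, c)\<close> is supported with finite slope even
  when \<open>\<phi>\<close> is infinite at or beyond \<open>u\<close>. The inequality is stated with \<open>b\<close> on the right
  because subtraction on \<open>ennreal\<close> truncates.\<close>

lemma orlicz_affine_minorant:
  assumes "orlicz_function \<phi>" "u > 0" "c \<ge> 0" "ennreal c < \<phi> u"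
  obtains a b where "a \<ge> 0" "b \<ge> 0" "c > 0 \<Longrightarrow> a > 0" "c + b \<le> a * u"
    "\<And>v. v \<ge> 0 \<Longrightarrow> ennreal (a * v) \<le> \<phi> v + ennreal b"
proof -
  have conv: "\<phi> ((1 - t) * x + t * y) \<le> ennreal (1 - t) * \<phi> x + ennreal t * \<phi> y"
    if "x \<ge> 0" "y \<ge> 0" "t \<in> {0..1}" for x y t
    using assms(1) that unfolding orlicz_function_def by blast
  have mono: "\<phi> x \<le> \<phi> y" if "0 \<le> x" "x \<le> y" for x y
    using assms(1) that unfolding orlicz_function_def by (auto simp: mono_on_def)
  have "(\<phi> \<longlongrightarrow> \<phi> u) (at_left u)" and zero: "\<phi> 0 = 0"
    using assms(1,2) unfolding orlicz_function_def by blast+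
  then have "eventually (\<lambda>v. ennreal c < \<phi> v) (at_left u)"
    using assms(4) by (intro order_tendstoD(1))
  then obtain d where d: "d < u" "\<And>y. d < y \<Longrightarrow> y < u \<Longrightarrow> ennreal c < \<phi> y"
    using eventually_at_left_real[of "u - 1" u] unfolding eventually_at_left_field by blast
  \<comment> \<open>Two points are kept below \<open>u\<close>: the line passes over
    \<open>u2\<close>, and the gap \<open>u2 - u1\<close> bounds its slope.\<close>
  define u1 where "u1 = (max d 0 + u) / 2"
  define u2 where "u2 = (u1 + u) / 2"
  have ord: "0 < u1" "u1 < u2" "u2 < u" "d < u1"
    using d(1) assms(2) by (auto simp: u1_def u2_def max_def field_simps)
  have above: "ennreal c < \<phi> v" if "u1 \<le> v" for v
    using d(2)[of u1] mono[of u1 v] ord that by auto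
  define p where "p v = enn2real (\<phi> v)" for v
  have p: "\<phi> v = ennreal (p v)" if "\<phi> v < \<infinity>" for v
    using that by (simp add: p_def)
  have p0: "p v \<ge> 0" for v by (simp add: p_def)
  \<comment> \<open>\<open>q v\<close> is the slope of the chord from \<open>(v, p v)\<close> to
    \<open>(u2, c)\<close>. The supremum \<open>a\<close> is the least slope that keeps the line
    through \<open>(u2, c)\<close> below \<open>\<phi>\<close> to the left of
    \<open>u2\<close>.\<close>
  define q where "q v = (c - p v) / (u2 - v)" for v
  define S where "S = q ` {v. 0 \<le> v \<and> v < u2 \<and> \<phi> v < \<infinity>}"
  define a where "a = Sup S"
  have bdd: "q v \<le> c / (u2 - u1)" if "0 \<le> v" "v < u2" "\<phi> v < \<infinity>" for v
  proof (cases "u1 \<le> v")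
    case True
    then have "c < p v" using above[OF True] p[OF that(3)] assms(3) by (simp add: ennreal_less_iff)
    then have "q v \<le> 0" using that by (simp add: q_def divide_nonpos_pos)
    also have "0 \<le> c / (u2 - u1)" using ord assms(3) by simp
    finally show ?thesis .
  next
    case False
    then show ?thesis unfolding q_def
      using assms(3) p0[of v] ord by (intro frac_le) auto
  qed
  have "bdd_above S" unfolding S_def using bdd by (intro bdd_aboveI2) auto
  then have q_le: "q v \<le> a" if "0 \<le> v" "v < u2" "\<phi> v < \<infinity>" for v
    unfolding a_def S_def using that by (intro cSup_upper) auto
  \<comment> \<open>The chord from the origin has slope \<open>c / u2\<close>. This makes
    \<open>a\<close> positive for \<open>c > 0\<close> and the constant \<open>a * u2 - c\<close>
    nonnegative.\<close>
  have a_ge: "c / u2 \<le> a"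
    using q_le[of 0] ord zero by (simp add: q_def p_def)
  then have a0: "a \<ge> 0" using assms(3) ord by (meson divide_nonneg_pos order_trans less_trans)
  have a_pos: "a > 0" if "c > 0" using a_ge that ord
    by (meson divide_pos_pos less_le_trans less_trans)
  have c_le: "c \<le> a * u2" using a_ge ord by (simp add: field_simps)
  have line: "c + a * (v - u2) \<le> p v" if v: "v \<ge> 0" "\<phi> v < \<infinity>" for v
  proof -
    consider "v < u2" | "v = u2" | "v > u2" by linarith
    then show ?thesis
    proof cases
      case 1
      then have "(c - p v) / (u2 - v) \<le> a" using q_le[of v] v by (simp add: q_def)
      then show ?thesis using 1 by (simp add: field_simps)
    next
      case 2
      then show ?thesis using above[of v] p[OF v(2)] ord assms(3) by (simp add: ennreal_less_iff)
    next
      case 3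
      \<comment> \<open>Convexity at \<open>u2\<close>, which lies between \<open>w\<close> and
        \<open>v\<close>, together with \<open>\<phi> u2 > c\<close> shows that no slope on the left
        exceeds a slope on the right.\<close>
      have "q w \<le> (p v - c) / (v - u2)" if w: "0 \<le> w" "w < u2" "\<phi> w < \<infinity>" for w
      proof -
        define t where "t = (u2 - w) / (v - w)"
        have t: "t \<in> {0..1}" using w 3 by (auto simp: t_def field_simps)
        have tt: "t * (v - w) = u2 - w" using w 3 by (simp add: t_def)
        then have "u2 = (1 - t) * w + t * v" by (simp add: algebra_simps)
        then have "\<phi> u2 \<le> ennreal (1 - t) * ennreal (p w) + ennreal t * ennreal (p v)"
          using conv[OF w(1) v(1) t] p[OF v(2)] p[OF w(3)] by simp
        also have "\<dots> = ennreal ((1 - t) * p w + t * p v)"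
          using t p0 by (simp add: ennreal_mult)
        finally have "ennreal c < ennreal ((1 - t) * p w + t * p v)"
          using above[of u2] ord by (simp add: less_le_trans)
        then have "c < (1 - t) * p w + t * p v"
          using assms(3) by (simp add: ennreal_less_iff)
        then have "c * (v - w) \<le> ((1 - t) * p w + t * p v) * (v - w)"
          using w 3 by (intro mult_right_mono) auto
        also have "\<dots> = (v - w) * p w + t * (v - w) * (p v - p w)"
          by (simp add: algebra_simps)
        finally have "c * (v - w) \<le> (v - w) * p w + (u2 - w) * (p v - p w)"
          unfolding tt .
        then have "(c - p w) * (v - u2) \<le> (p v - c) * (u2 - w)"
          by (simp add: algebra_simps)
        then show ?thesis unfolding q_def using w 3
          by (simp add: divide_le_eq le_divide_eq field_simps)
      qed
      moreover have "S \<noteq> {}" unfolding S_def using zero ord by (auto intro!: exI[of _ 0])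
      ultimately have "a \<le> (p v - c) / (v - u2)"
        unfolding a_def by (intro cSup_least) (auto simp: S_def)
      then show ?thesis using 3 by (simp add: field_simps)
    qed
  qed
  show thesis
  proof (rule that[of a "a * u2 - c"])
    show "c + (a * u2 - c) \<le> a * u" using a0 ord by (simp add: mult_left_mono)
    show "ennreal (a * v) \<le> \<phi> v + ennreal (a * u2 - c)" if "v \<ge> 0" for v
    proof (cases "\<phi> v < \<infinity>")
      case True
      have "ennreal (a * v) \<le> ennreal (p v + (a * u2 - c))"
        using line[OF that True] by (intro ennreal_leI) (simp add: algebra_simps)
      also have "\<dots> = \<phi> v + ennreal (a * u2 - c)"
        using p[OF True] p0 c_le by simp
      finally show ?thesis .
    qed (auto simp: less_top[symmetric])
  qed (use a0 a_pos c_le in auto)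
qed

lemma orlicz_ext_mono:
  assumes "orlicz_function \<phi>" "u \<le> v"
  shows "orlicz_ext \<phi> u \<le> orlicz_ext \<phi> v"
  using assms unfolding orlicz_ext_def orlicz_function_def
  by (auto simp: top_unique mono_on_def less_top enn2real_mono)

text \<open>By monotonicity each strict sublevel set is a down-set of the complete linear order
  \<open>ennreal\<close>, hence a ray, closed exactly if it contains its supremum.\<close>

lemma orlicz_ext_measurable [measurable]:
  assumes "orlicz_function \<phi>"
  shows "orlicz_ext \<phi> \<in> borel_measurable borel"
proof (rule borel_measurableI_less)
  fix y
  have intervals: "X \<in> sets borel" if "X = {..<s} \<or> X = {..s}" for X :: "ennreal set" and s
    using that by auto
  have "\<exists>s. {x. orlicz_ext \<phi> x < y} = {..<s} \<or> {x. orlicz_ext \<phi> x < y} = {..s}"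
  proof -
    let ?A = "{x. orlicz_ext \<phi> x < y}"
    have down: "x \<in> ?A" if "z \<in> ?A" "x \<le> z" for x z
      using orlicz_ext_mono[OF assms that(2)] that(1) by auto
    show ?thesis
    proof (cases "Sup ?A \<in> ?A")
      case True
      then have "?A = {..Sup ?A}" using down[OF True] Sup_upper[of _ ?A] by blast
      then show ?thesis by blast
    next
      case False
      have "?A = {..<Sup ?A}"
      proof (intro set_eqI iffI)
        fix x assume "x \<in> ?A"
        then show "x \<in> {..<Sup ?A}" using False Sup_upper[of x ?A] by (auto simp: less_le)
      next
        fix x assume "x \<in> {..<Sup ?A}"
        then obtain z where "z \<in> ?A" "x < z" by (auto simp: less_Sup_iff)
        then show "x \<in> ?A" using down by auto
      qed
      then show ?thesis by blast
    qed
  qed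
  then obtain s where "{x. orlicz_ext \<phi> x < y} = {..<s} \<or> {x. orlicz_ext \<phi> x < y} = {..s}" ..
  from intervals[OF this] show "{x \<in> space borel. orlicz_ext \<phi> x < y} \<in> sets borel"
    unfolding space_borel by (simp only: UNIV_I simp_thms)
qed

text \<open>Integrating an affine minorant against \<open>w\<close> bounds \<open>a * ?m\<close> by
  \<open>?R + b\<close>; mass at most 1 is enough because \<open>b \<ge> 0\<close>. Minorants that
  come close to \<open>\<phi>\<close> at the mean then give the claim.\<close>

lemma orlicz_ext_jensen:
  assumes \<phi>: "orlicz_function \<phi>"
    and [measurable]: "w \<in> borel_measurable M" "h \<in> borel_measurable M"
    and w: "(\<integral>\<^sup>+x. w x \<partial>M) \<le> 1"
  shows "orlicz_ext \<phi> (\<integral>\<^sup>+x. w x * h x \<partial>M) \<le> (\<integral>\<^sup>+x. w x * orlicz_ext \<phi> (h x) \<partial>M)"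
    (is "orlicz_ext \<phi> ?m \<le> ?R")
proof -
  note [measurable] = orlicz_ext_measurable[OF \<phi>]
  have minorant: "ennreal a * ?m \<le> ?R + ennreal b"
    if ab: "a \<ge> 0" "b \<ge> 0" "\<And>v. v \<ge> 0 \<Longrightarrow> ennreal (a * v) \<le> \<phi> v + ennreal b" for a b
  proof -
    have "ennreal a * z \<le> orlicz_ext \<phi> z + ennreal b" for z
      using ab(3)[of "enn2real z"] ab(1)
      by (cases z) (auto simp: orlicz_ext_def ennreal_mult)
    then have "w x * (ennreal a * h x) \<le> w x * (orlicz_ext \<phi> (h x) + ennreal b)" for x
      by (intro mult_left_mono) auto
    then have "(\<integral>\<^sup>+x. ennreal a * (w x * h x) \<partial>M)
      \<le> (\<integral>\<^sup>+x. w x * orlicz_ext \<phi> (h x) + ennreal b * w x \<partial>M)"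
      by (intro nn_integral_mono) (simp add: algebra_simps)
    also have "\<dots> = ?R + ennreal b * (\<integral>\<^sup>+x. w x \<partial>M)"
      by (simp add: nn_integral_add nn_integral_cmult)
    also have "\<dots> \<le> ?R + ennreal b * 1"
      by (intro add_left_mono mult_left_mono w) auto
    finally show ?thesis by (simp add: nn_integral_cmult)
  qed
  consider "?m = \<infinity>" | "?m = 0" | u where "u > 0" "?m = ennreal u"
    by (cases "?m") (auto simp: less_le)
  then show ?thesis
  proof cases
    case 1
    \<comment> \<open>For an infinite mean a single minorant of positive slope forces
      \<open>?R\<close> to be infinite. The level 1 is an arbitrary positive value.\<close>
    have "(\<phi> \<longlongrightarrow> \<infinity>) at_top" using \<phi> unfolding orlicz_function_def by blast
    then have "eventually (\<lambda>u. ennreal 1 < \<phi> u) at_top"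
      by (intro order_tendstoD(1)) auto
    moreover have "eventually (\<lambda>u::real. u > 0) at_top" by (rule eventually_gt_at_top)
    ultimately have "eventually (\<lambda>u. u > 0 \<and> ennreal 1 < \<phi> u) at_top"
      by eventually_elim auto
    then obtain u where u: "u > 0" "ennreal 1 < \<phi> u"
      using eventually_happens'[OF trivial_limit_at_top_linorder] by blast
    obtain a b where ab: "a \<ge> 0" "b \<ge> 0" "a > 0"
      "\<And>v. v \<ge> 0 \<Longrightarrow> ennreal (a * v) \<le> \<phi> v + ennreal b"
      using orlicz_affine_minorant[OF \<phi> u(1) _ u(2)] by (metis zero_le_one zero_less_one)
    have "ennreal a * ?m \<le> ?R + ennreal b" by (rule minorant[OF ab(1,2,4)])
    then have "?R = \<infinity>" using 1 ab(3) by (auto simp: ennreal_mult_top top_unique)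
    then show ?thesis by simp
  next
    case 2
    then show ?thesis using \<phi> by (simp add: orlicz_ext_def orlicz_function_def)
  next
    case 3
    have "\<phi> u \<le> ?R"
    proof (rule ccontr)
      assume "\<not> \<phi> u \<le> ?R"
      then have "?R < \<phi> u" by simp
      \<comment> \<open>The minorant that reaches the intermediate level \<open>d\<close> at
        \<open>u\<close> puts \<open>d\<close> below \<open>?R\<close>, once the finite
        \<open>b\<close> is cancelled.\<close>
      then obtain d where d: "?R < d" "d < \<phi> u" using dense by blast
      then obtain c where c: "d = ennreal c" "c \<ge> 0" by (cases d) auto
      obtain a b where ab: "a \<ge> 0" "b \<ge> 0" "c + b \<le> a * u"
        "\<And>v. v \<ge> 0 \<Longrightarrow> ennreal (a * v) \<le> \<phi> v + ennreal b"
        using orlicz_affine_minorant[OF \<phi> 3(1) c(2)] d c by metis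
      have "ennreal c + ennreal b = ennreal (c + b)" using c ab by simp
      also have "\<dots> \<le> ennreal (a * u)" using ab by (intro ennreal_leI)
      also have "\<dots> = ennreal a * ?m" using 3 ab by (simp add: ennreal_mult)
      also have "\<dots> \<le> ?R + ennreal b" by (rule minorant[OF ab(1,2,4)])
      finally have "ennreal c \<le> ?R" by (simp add: ennreal_add_left_cancel_le add.commute[of _ "ennreal b"])
      then show False using d c by auto
    qed
    then show ?thesis using 3 by (simp add: orlicz_ext_def)
  qed
qed


section \<open>The mixed modular of \<open>ennreal\<close>-valued functions: measurability and
  monotonicity\<close>

text \<open>Integrating against \<open>lborel\<close> makes Tonelli available on the uncompleted
  products \<open>lborel_on\<close>.\<close>

primrec nn_modular ::
  "(nat \<Rightarrow> real \<Rightarrow> ennreal) \<Rightarrow> ((nat \<Rightarrow> real) \<Rightarrow> ennreal) \<Rightarrow> nat \<Rightarrow> (nat \<Rightarrow> real) \<Rightarrow> ennreal" where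
  "nn_modular \<Phi> g 0 x = g x"
| "nn_modular \<Phi> g (Suc m) x =
     (\<integral>\<^sup>+ t\<in>{-1..1}. orlicz_ext (\<Phi> (Suc m)) (nn_modular \<Phi> g m (x(Suc m := t))) \<partial>lborel)"

text \<open>Completing a measure leaves the nonnegative integral of every function unchanged, even
  at non-measurable sections.\<close>

lemma partial_modular_eq_nn_modular:
  "partial_modular \<Phi> f m x = nn_modular \<Phi> (\<lambda>x. ennreal \<bar>f x\<bar>) m x"
  by (induction m arbitrary: x) (auto simp: nn_integral_completion)

abbreviation lborel_on :: "nat set \<Rightarrow> (nat \<Rightarrow> real) measure" where
  "lborel_on I \<equiv> Pi\<^sub>M I (\<lambda>_. lborel)"

interpretation lborel_product: product_sigma_finite "\<lambda>_::nat. lborel :: real measure"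
  by standard

lemma atLeastAtMost_Suc_insert: "m < r \<Longrightarrow> {Suc m..r} = insert (Suc m) {Suc (Suc m)..r}"
  by auto

lemma nn_modular_measurable:
  assumes "\<And>j. j \<in> {1..r} \<Longrightarrow> orlicz_function (\<Phi> j)"
    and "g \<in> borel_measurable (lborel_on {1..r})" "m \<le> r"
  shows "nn_modular \<Phi> g m \<in> borel_measurable (lborel_on {Suc m..r})"
  using assms(3)
proof (induction m)
  case 0
  then show ?case using assms(2) by simp
next
  case (Suc m)
  let ?I = "{Suc (Suc m)..r}"
  have [measurable]: "nn_modular \<Phi> g m \<in> borel_measurable (lborel_on (insert (Suc m) ?I))"
    using Suc atLeastAtMost_Suc_insert[of m r] by simp
  have [measurable]: "orlicz_ext (\<Phi> (Suc m)) \<in> borel_measurable borel"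
    using Suc assms(1) by (intro orlicz_ext_measurable) auto
  have [measurable]: "(\<lambda>(x, t). x(Suc m := t)) \<in> lborel_on ?I \<Otimes>\<^sub>M lborel \<rightarrow>\<^sub>M lborel_on (insert (Suc m) ?I)"
    by (rule measurable_add_dim)
  show ?case by simp measurable
qed

text \<open>The exceptional points lie in a measurable null set, and by Tonelli almost all of its
  sections in direction \<open>i\<close> are null.\<close>

lemma AE_lborel_on_insert:
  assumes "finite I" "i \<notin> I" "AE z in lborel_on (insert i I). P z"
  shows "AE y in lborel_on I. AE t in lborel. P (y(i := t))"
proof -
  obtain N where N: "{z \<in> space (lborel_on (insert i I)). \<not> P z} \<subseteq> N"
    "emeasure (lborel_on (insert i I)) N = 0" and [measurable]: "N \<in> sets (lborel_on (insert i I))"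
    using assms(3) by (auto elim!: AE_E)
  have [measurable]: "(\<lambda>(x, t). x(i := t)) \<in> lborel_on I \<Otimes>\<^sub>M lborel \<rightarrow>\<^sub>M lborel_on (insert i I)"
    by (rule measurable_add_dim)
  have "0 = (\<integral>\<^sup>+z. indicator N z \<partial>lborel_on (insert i I))" using N by simp
  also have "\<dots> = (\<integral>\<^sup>+y. \<integral>\<^sup>+t. indicator N (y(i := t)) \<partial>lborel \<partial>lborel_on I)"
    using assms by (subst lborel_product.product_nn_integral_insert) auto
  finally have "AE y in lborel_on I. (\<integral>\<^sup>+t. indicator N (y(i := t)) \<partial>lborel) = 0"
    by (subst (asm) eq_commute, subst (asm) nn_integral_0_iff_AE) measurable
  with AE_space show ?thesis
  proof eventually_elim
    case (elim y)
    note y = elim(1) and zero = elim(2)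
    have [measurable]: "(\<lambda>t. y(i := t)) \<in> lborel \<rightarrow>\<^sub>M lborel_on (insert i I)"
      using measurable_component_update[OF y assms(2)] by simp
    have "AE t in lborel. (indicator N (y(i := t)) :: ennreal) = 0"
      using zero by (subst (asm) nn_integral_0_iff_AE) measurable
    then show "AE t in lborel. P (y(i := t))"
    proof (rule AE_mp, intro AE_I2 impI)
      fix t assume "(indicator N (y(i := t)) :: ennreal) = 0"
      then have "y(i := t) \<notin> N" by (auto simp: indicator_def split: if_splits)
      moreover have "y(i := t) \<in> space (lborel_on (insert i I))"
        using y by (auto simp: space_PiM PiE_iff extensional_def)
      ultimately show "P (y(i := t))" using N(1) by auto
    qed
  qed
qed

text \<open>No measurability of \<open>g\<close> and \<open>h\<close> is available: sections of a Lebesgue measurable function need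
  not be measurable, and \<open>nn_integral\<close> is then a lower integral.\<close>

lemma nn_modular_mono_AE:
  assumes "\<And>j. j \<in> {1..r} \<Longrightarrow> orlicz_function (\<Phi> j)"
    and "AE x in lborel_on {1..r}. x \<in> cube r \<longrightarrow> g x \<le> h x" "m \<le> r"
  shows "AE x in lborel_on {Suc m..r}. x \<in> {Suc m..r} \<rightarrow>\<^sub>E {-1..1} \<longrightarrow>
    nn_modular \<Phi> g m x \<le> nn_modular \<Phi> h m x"
  using assms(3)
proof (induction m)
  case 0
  then show ?case using assms(2) unfolding cube_def One_nat_def by simp
next
  case (Suc m)
  let ?I = "{Suc (Suc m)..r}"
  have I: "{Suc m..r} = insert (Suc m) ?I"
    using Suc.prems atLeastAtMost_Suc_insert[of m r] by simp
  have "AE y in lborel_on ?I. AE t in lborel. y(Suc m := t) \<in> {Suc m..r} \<rightarrow>\<^sub>E {-1..1} \<longrightarrow>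
    nn_modular \<Phi> g m (y(Suc m := t)) \<le> nn_modular \<Phi> h m (y(Suc m := t))"
    using Suc unfolding I by (intro AE_lborel_on_insert) auto
  then show ?case
  proof (rule AE_mp, intro AE_I2 impI)
    fix y assume ae: "AE t in lborel. y(Suc m := t) \<in> {Suc m..r} \<rightarrow>\<^sub>E {-1..1} \<longrightarrow>
        nn_modular \<Phi> g m (y(Suc m := t)) \<le> nn_modular \<Phi> h m (y(Suc m := t))"
      and y: "y \<in> ?I \<rightarrow>\<^sub>E {-1..1}"
    show "nn_modular \<Phi> g (Suc m) y \<le> nn_modular \<Phi> h (Suc m) y"
      unfolding nn_modular.simps
    proof (rule nn_integral_mono_AE, use ae in \<open>rule AE_mp\<close>, intro AE_I2 impI)
      fix t
      assume *: "y(Suc m := t) \<in> {Suc m..r} \<rightarrow>\<^sub>E {-1..1} \<longrightarrow>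
        nn_modular \<Phi> g m (y(Suc m := t)) \<le> nn_modular \<Phi> h m (y(Suc m := t))"
      \<comment> \<open>Inside the interval the point stays in the box; outside it the indicator
        makes both sides 0.\<close>
      have "t \<in> {-1..1} \<Longrightarrow> y(Suc m := t) \<in> {Suc m..r} \<rightarrow>\<^sub>E {-1..1}"
        using y unfolding I by (intro PiE_fun_upd) auto
      then show "orlicz_ext (\<Phi> (Suc m)) (nn_modular \<Phi> g m (y(Suc m := t))) * indicator {-1..1} t
        \<le> orlicz_ext (\<Phi> (Suc m)) (nn_modular \<Phi> h m (y(Suc m := t))) * indicator {-1..1} t"
        using * Suc.prems assms(1)[of "Suc m"]
        by (auto simp: indicator_def intro!: orlicz_ext_mono)
    qed
  qed
qed

text \<open>With all coordinates integrated out, the remaining measure is a point mass at the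
  undefined function, so the almost everywhere inequality is a pointwise one.\<close>

lemma nn_modular_mono_AE_cube:
  assumes "\<And>j. j \<in> {1..r} \<Longrightarrow> orlicz_function (\<Phi> j)"
    and "AE x in lborel_on {1..r}. x \<in> cube r \<longrightarrow> g x \<le> h x"
  shows "nn_modular \<Phi> g r (\<lambda>_. undefined) \<le> nn_modular \<Phi> h r (\<lambda>_. undefined)"
proof -
  have "AE x in lborel_on {}. x \<in> {} \<rightarrow>\<^sub>E {-1..1} \<longrightarrow> nn_modular \<Phi> g r x \<le> nn_modular \<Phi> h r x"
    using nn_modular_mono_AE[OF assms order_refl] by simp
  then show ?thesis unfolding PiM_empty AE_count_space by simp
qed

section \<open>Averaging against product kernels, one coordinate at a time\<close>

lemma prod_le_1_ennreal:
  fixes f :: "'a \<Rightarrow> ennreal"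
  assumes "\<And>i. i \<in> I \<Longrightarrow> f i \<le> 1"
  shows "prod f I \<le> 1"
  using assms
proof (induction I rule: infinite_finite_induct)
  case (insert i I)
  then show ?case using mult_mono[of "f i" 1 "prod f I" 1] by simp
qed auto

text \<open>By Jensen's inequality, averaging against a substochastic product kernel commutes, up to
  an inequality, with the integrations of the mixed modular; the coordinate that is integrated
  out disappears from the kernel because the kernel is also substochastic in its first argument.\<close>

lemma nn_modular_kernel_le:
  fixes \<kappa> :: "real \<Rightarrow> real \<Rightarrow> ennreal"
  assumes orlicz: "\<And>j. j \<in> {1..r} \<Longrightarrow> orlicz_function (\<Phi> j)"
    and \<kappa>[measurable]: "case_prod \<kappa> \<in> borel_measurable (borel \<Otimes>\<^sub>M borel)"
    and row: "\<And>s. (\<integral>\<^sup>+t. \<kappa> s t \<partial>lborel) \<le> 1"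
    and column: "AE t in lborel. (\<integral>\<^sup>+s. \<kappa> s t \<partial>lborel) \<le> indicator {-1..1} t"
    and G: "G \<in> borel_measurable (lborel_on {1..r})"
    and F: "\<And>x. x \<in> cube r \<Longrightarrow> F x \<le> (\<integral>\<^sup>+y. (\<Prod>j\<in>{1..r}. \<kappa> (x j) (y j)) * G y \<partial>lborel_on {1..r})"
    and m: "m \<le> r" and x: "x \<in> {Suc m..r} \<rightarrow>\<^sub>E {-1..1}"
  shows "nn_modular \<Phi> F m x \<le>
    (\<integral>\<^sup>+y. (\<Prod>j\<in>{Suc m..r}. \<kappa> (x j) (y j)) * nn_modular \<Phi> G m y \<partial>lborel_on {Suc m..r})"
  using m x
proof (induction m arbitrary: x)
  case 0
  then show ?case using F by (simp add: cube_def)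
next
  case (Suc m)
  let ?i = "Suc m" and ?I = "{Suc (Suc m)..r}"
  let ?J = "insert ?i ?I"
  let ?\<phi> = "orlicz_ext (\<Phi> ?i)"
  let ?Q = "nn_modular \<Phi> G m"
  \<comment> \<open>The kernels of the coordinates that remain after this step; \<open>W\<close> is
    constant in coordinate \<open>?i\<close>.\<close>
  define W where "W y = (\<Prod>j\<in>?I. \<kappa> (x j) (y j))" for y
  have I: "{Suc m..r} = ?J"
    using Suc.prems atLeastAtMost_Suc_insert[of m r] by simp
  have \<phi>: "orlicz_function (\<Phi> ?i)" using Suc.prems orlicz by simp
  note [measurable] = orlicz_ext_measurable[OF \<phi>]
  have [measurable]: "?Q \<in> borel_measurable (lborel_on ?J)"
    using nn_modular_measurable[OF orlicz G] Suc.prems unfolding I[symmetric] by simp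
  have \<kappa>_comp [measurable]: "(\<lambda>z. \<kappa> (f z) (g z)) \<in> borel_measurable M"
    if "f \<in> borel_measurable M" "g \<in> borel_measurable M"
    for f g and M :: "'z measure"
    using measurable_compose[OF measurable_Pair[OF that] \<kappa>] by simp
  have W_insert: "W (y(?i := t)) = W y" for y t
    unfolding W_def by (intro prod.cong) auto
  have [measurable]: "W \<in> borel_measurable (lborel_on ?J)"
    unfolding W_def by measurable
  have [measurable]: "W \<in> borel_measurable (lborel_on ?I)"
    unfolding W_def by measurable
  have [measurable]: "(\<lambda>(y, t). y(?i := t)) \<in> lborel_on ?I \<Otimes>\<^sub>M lborel \<rightarrow>\<^sub>M lborel_on ?J"
    by (rule measurable_add_dim)
  \<comment> \<open>The weight for Jensen's inequality: its integral factors into row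
    integrals.\<close>
  have Wle: "(\<integral>\<^sup>+y. \<kappa> s (y ?i) * W y \<partial>lborel_on ?J) \<le> 1" for s
  proof -
    have "(\<integral>\<^sup>+y. \<kappa> s (y ?i) * W y \<partial>lborel_on ?J)
      = (\<integral>\<^sup>+y. (\<Prod>j\<in>?J. \<kappa> ((x(?i := s)) j) (y j)) \<partial>lborel_on ?J)"
      by (intro nn_integral_cong) (auto simp: W_def intro!: prod.cong)
    also have "\<dots> = (\<Prod>j\<in>?J. \<integral>\<^sup>+t. \<kappa> ((x(?i := s)) j) t \<partial>lborel)"
      by (rule lborel_product.product_nn_integral_prod) (auto intro: \<kappa>_comp)
    also have "\<dots> \<le> 1"
      using row by (intro prod_le_1_ennreal) auto
    finally show ?thesis .
  qed
  have step: "?\<phi> (nn_modular \<Phi> F m (x(?i := s))) * indicator {-1..1} s \<le>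
     (\<integral>\<^sup>+y. \<kappa> s (y ?i) * W y * ?\<phi> (?Q y) \<partial>lborel_on ?J)" for s
  proof (cases "s \<in> {-1..1}")
    case True
    have xs: "x(?i := s) \<in> ?J \<rightarrow>\<^sub>E {-1..1}"
      using Suc.prems(2) True by (intro PiE_fun_upd) auto
    have "nn_modular \<Phi> F m (x(?i := s)) \<le>
      (\<integral>\<^sup>+y. (\<Prod>j\<in>?J. \<kappa> ((x(?i := s)) j) (y j)) * ?Q y \<partial>lborel_on ?J)"
      by (rule Suc.IH[unfolded I, OF _ xs]) (use Suc.prems(1) in simp)
    also have "\<dots> = (\<integral>\<^sup>+y. \<kappa> s (y ?i) * W y * ?Q y \<partial>lborel_on ?J)"
      by (intro nn_integral_cong) (auto simp: W_def intro!: arg_cong2[where f="(*)"] prod.cong)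
    finally have "?\<phi> (nn_modular \<Phi> F m (x(?i := s))) \<le>
      ?\<phi> (\<integral>\<^sup>+y. \<kappa> s (y ?i) * W y * ?Q y \<partial>lborel_on ?J)"
      by (rule orlicz_ext_mono[OF \<phi>])
    also have "\<dots> \<le> (\<integral>\<^sup>+y. \<kappa> s (y ?i) * W y * ?\<phi> (?Q y) \<partial>lborel_on ?J)"
      by (rule orlicz_ext_jensen[OF \<phi> _ _ Wle]) measurable
    finally show ?thesis using True by simp
  qed simp
  interpret J: sigma_finite_measure "lborel_on ?J"
    by (rule lborel_product.sigma_finite) simp
  interpret pair_sigma_finite lborel "lborel_on ?J" ..
  have "nn_modular \<Phi> F ?i x \<le> (\<integral>\<^sup>+s. \<integral>\<^sup>+y. \<kappa> s (y ?i) * W y * ?\<phi> (?Q y) \<partial>lborel_on ?J \<partial>lborel)"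
    unfolding nn_modular.simps by (intro nn_integral_mono step)
  \<comment> \<open>After the exchange, \<open>s\<close> occurs in one kernel factor only, so the
    inner integral becomes a column integral.\<close>
  also have "\<dots> = (\<integral>\<^sup>+y. \<integral>\<^sup>+s. \<kappa> s (y ?i) * W y * ?\<phi> (?Q y) \<partial>lborel \<partial>lborel_on ?J)"
    by (rule Fubini'[symmetric]) measurable
  also have "\<dots> = (\<integral>\<^sup>+y. (\<integral>\<^sup>+s. \<kappa> s (y ?i) \<partial>lborel) * (W y * ?\<phi> (?Q y)) \<partial>lborel_on ?J)"
    by (intro nn_integral_cong) (simp add: mult.assoc nn_integral_multc)
  also have "\<dots> = (\<integral>\<^sup>+y. \<integral>\<^sup>+t. (\<integral>\<^sup>+s. \<kappa> s t \<partial>lborel) * (W y * ?\<phi> (?Q (y(?i := t)))) \<partial>lborel \<partial>lborel_on ?I)"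
    by (subst lborel_product.product_nn_integral_insert) (auto simp: W_insert)
  \<comment> \<open>The column bound removes \<open>s\<close> and confines \<open>t\<close> to the
    interval over which the modular integrates.\<close>
  also have "\<dots> \<le> (\<integral>\<^sup>+y. W y * nn_modular \<Phi> G ?i y \<partial>lborel_on ?I)"
  proof (rule nn_integral_mono)
    fix y assume y: "y \<in> space (lborel_on ?I)"
    have [measurable]: "(\<lambda>t. y(?i := t)) \<in> lborel \<rightarrow>\<^sub>M lborel_on ?J"
      using y measurable_component_update[OF y, of ?i] by simp
    have "(\<integral>\<^sup>+t. (\<integral>\<^sup>+s. \<kappa> s t \<partial>lborel) * (W y * ?\<phi> (?Q (y(?i := t)))) \<partial>lborel)
      \<le> (\<integral>\<^sup>+t. indicator {-1..1} t * (W y * ?\<phi> (?Q (y(?i := t)))) \<partial>lborel)"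
      using column by (intro nn_integral_mono_AE) (elim eventually_mono, rule mult_right_mono, auto)
    also have "\<dots> = (\<integral>\<^sup>+t. W y * (?\<phi> (?Q (y(?i := t))) * indicator {-1..1} t) \<partial>lborel)"
      by (intro nn_integral_cong) (simp add: mult_ac)
    also have "\<dots> = W y * nn_modular \<Phi> G ?i y"
      unfolding nn_modular.simps by (rule nn_integral_cmult) measurable
    finally show "(\<integral>\<^sup>+t. (\<integral>\<^sup>+s. \<kappa> s t \<partial>lborel) * (W y * ?\<phi> (?Q (y(?i := t)))) \<partial>lborel) \<le> \<dots>" .
  qed
  finally show ?case unfolding W_def .
qed

text \<open>The case \<open>m = r\<close>: the kernel product is empty, and the integral is
  evaluation at the undefined point.\<close>

lemma nn_modular_kernel_le_cube:
  fixes \<kappa> :: "real \<Rightarrow> real \<Rightarrow> ennreal"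
  assumes "\<And>j. j \<in> {1..r} \<Longrightarrow> orlicz_function (\<Phi> j)"
    and "case_prod \<kappa> \<in> borel_measurable (borel \<Otimes>\<^sub>M borel)"
    and "\<And>s. (\<integral>\<^sup>+t. \<kappa> s t \<partial>lborel) \<le> 1"
    and "AE t in lborel. (\<integral>\<^sup>+s. \<kappa> s t \<partial>lborel) \<le> indicator {-1..1} t"
    and "G \<in> borel_measurable (lborel_on {1..r})"
    and "\<And>x. x \<in> cube r \<Longrightarrow> F x \<le> (\<integral>\<^sup>+y. (\<Prod>j\<in>{1..r}. \<kappa> (x j) (y j)) * G y \<partial>lborel_on {1..r})"
  shows "nn_modular \<Phi> F r (\<lambda>_. undefined) \<le> nn_modular \<Phi> G r (\<lambda>_. undefined)"
proof -
  have "nn_modular \<Phi> F r (\<lambda>_. undefined) \<le>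
    (\<integral>\<^sup>+y. (\<Prod>j\<in>{Suc r..r}. \<kappa> undefined (y j)) * nn_modular \<Phi> G r y \<partial>lborel_on {Suc r..r})"
    by (rule nn_modular_kernel_le[OF assms order_refl]) simp_all
  then show ?thesis by (simp add: lborel_product.nn_integral_empty)
qed


section \<open>The one-dimensional Kantorovich kernel\<close>

text \<open>The kernel \<kappa> of the overview. Closed intervals make the product over coordinates
  reproduce \<open>grid_cell\<close> exactly.\<close>

definition kantorovich_kernel :: "(real \<Rightarrow> real) \<Rightarrow> nat \<Rightarrow> real \<Rightarrow> real \<Rightarrow> ennreal" where
  "kantorovich_kernel \<rho> n s t = (\<Sum>k = - int n..int n - 1. ennreal (real n * Psi \<rho> (real n * s - real_of_int k)) *
     indicator {real_of_int k / real n..(real_of_int k + 1) / real n} t)"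

lemma Psi_nonneg: "mono \<rho> \<Longrightarrow> 0 \<le> Psi \<rho> x"
  unfolding Psi_def by (simp add: monoD)

lemma Psi_measurable:
  assumes "mono \<rho>"
  shows "Psi \<rho> \<in> borel_measurable borel"
proof -
  note [measurable] = borel_measurable_mono[OF assms]
  show ?thesis unfolding Psi_def by measurable
qed

lemma kantorovich_kernel_measurable:
  assumes "mono \<rho>"
  shows "case_prod (kantorovich_kernel \<rho> n) \<in> borel_measurable (borel \<Otimes>\<^sub>M borel)"
proof -
  note [measurable] = Psi_measurable[OF assms]
  show ?thesis unfolding kantorovich_kernel_def by measurable
qed

text \<open>The cell length \<open>1 / n\<close> cancels the factor \<open>n\<close>, leaving a
  finite part of the nonnegative series of translates.\<close>

lemma kantorovich_kernel_row:
  assumes "mono \<rho>" "n \<ge> 1"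
    and sum1: "\<And>x. ((\<lambda>k::int. Psi \<rho> (x - real_of_int k)) has_sum 1) UNIV"
  shows "(\<integral>\<^sup>+t. kantorovich_kernel \<rho> n s t \<partial>lborel) \<le> 1"
proof -
  have "(\<integral>\<^sup>+t. kantorovich_kernel \<rho> n s t \<partial>lborel) =
    (\<Sum>k = - int n..int n - 1. ennreal (real n * Psi \<rho> (real n * s - real_of_int k)) *
       emeasure lborel {real_of_int k / real n..(real_of_int k + 1) / real n})"
    unfolding kantorovich_kernel_def
    by (subst nn_integral_sum) (auto simp only: intro!: sum.cong nn_integral_cmult_indicator, measurable)
  also have "\<dots> = (\<Sum>k = - int n..int n - 1. ennreal (Psi \<rho> (real n * s - real_of_int k)))"
  proof (rule sum.cong)
    fix k
    have "(real_of_int k + 1) / real n - real_of_int k / real n = 1 / real n"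
      by (simp add: diff_divide_distrib[symmetric])
    then show "ennreal (real n * Psi \<rho> (real n * s - real_of_int k)) *
       emeasure lborel {real_of_int k / real n..(real_of_int k + 1) / real n}
       = ennreal (Psi \<rho> (real n * s - real_of_int k))"
      using assms(2) Psi_nonneg[OF assms(1)]
      by (simp add: divide_right_mono ennreal_mult[symmetric])
  qed simp
  also have "\<dots> = ennreal (\<Sum>k = - int n..int n - 1. Psi \<rho> (real n * s - real_of_int k))"
    using Psi_nonneg[OF assms(1)] by simp
  also have "\<dots> \<le> ennreal 1"
    by (intro ennreal_leI finite_sum_le_has_sum[OF sum1]) (auto simp: Psi_nonneg[OF assms(1)])
  finally show ?thesis by simp
qed

text \<open>The closed cells overlap at the grid points, which are therefore excluded.\<close>

lemma sum_indicator_grid_le: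
  assumes "n \<ge> 1" and off: "\<And>k::int. t \<noteq> real_of_int k / real n"
  shows "(\<Sum>k = - int n..int n - 1. indicator {real_of_int k / real n..(real_of_int k + 1) / real n} t)
    \<le> (indicator {-1..1} t :: ennreal)"
proof -
  have n: "real n > 0" using assms(1) by simp
  have cell: "k = \<lfloor>real n * t\<rfloor>"
    if "t \<in> {real_of_int k / real n..(real_of_int k + 1) / real n}" for k
  proof -
    \<comment> \<open>The right endpoint is the grid point of index \<open>k + 1\<close>, excluded
      by \<open>off\<close>; the half-open cell determines \<open>k\<close> as a floor.\<close>
    have "t < (real_of_int k + 1) / real n"
      using that off[of "k + 1"] by (intro order.not_eq_order_implies_strict) auto
    then show ?thesis using that n
      by (intro floor_unique[symmetric]) (auto simp: field_simps)
  qed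
  show ?thesis
  proof (cases "t \<in> {-1..1}")
    case True
    have "(\<Sum>k = - int n..int n - 1. indicator {real_of_int k / real n..(real_of_int k + 1) / real n} t)
      \<le> (\<Sum>k = - int n..int n - 1. if k = \<lfloor>real n * t\<rfloor> then 1 else 0 :: ennreal)"
    proof (rule sum_mono)
      fix k show "indicator {real_of_int k / real n..(real_of_int k + 1) / real n} t
          \<le> (if k = \<lfloor>real n * t\<rfloor> then 1 else 0 :: ennreal)"
        using cell[of k] by (cases "k = \<lfloor>real n * t\<rfloor>") (auto simp: indicator_def)
    qed
    also have "\<dots> \<le> 1" by simp
    finally show ?thesis using True by simp
  next
    case False
    have "t \<notin> {real_of_int k / real n..(real_of_int k + 1) / real n}"
      if k: "k \<in> {- int n..int n - 1}" for k
    proof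
      assume t: "t \<in> {real_of_int k / real n..(real_of_int k + 1) / real n}"
      have "-1 \<le> real_of_int k / real n" "(real_of_int k + 1) / real n \<le> 1"
        using k n by (simp_all add: field_simps)
      then show False using t False by auto
    qed
    then show ?thesis using False by simp
  qed
qed

text \<open>The substitution \<open>x = n * s - k\<close> turns every summand into the integral of
  \<open>Psi \<rho>\<close>, which is 1. What remains counts the cells containing \<open>t\<close>,
  and the grid points form a countable null set.\<close>

lemma kantorovich_kernel_column:
  assumes "mono \<rho>" "n \<ge> 1" and int1: "has_bochner_integral lebesgue (Psi \<rho>) 1"
  shows "AE t in lborel. (\<integral>\<^sup>+s. kantorovich_kernel \<rho> n s t \<partial>lborel) \<le> indicator {-1..1} t"
proof -
  note [measurable] = Psi_measurable[OF assms(1)]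
  have "(\<integral>\<^sup>+x. ennreal (Psi \<rho> x) \<partial>lebesgue) = ennreal 1"
    using int1 Psi_nonneg[OF assms(1)] by (simp add: has_bochner_integral_iff nn_integral_eq_integral)
  then have Psi1: "(\<integral>\<^sup>+x. ennreal (Psi \<rho> x) \<partial>lborel) = 1"
    by (simp add: nn_integral_completion)
  have scaled: "(\<integral>\<^sup>+s. ennreal (real n * Psi \<rho> (real n * s - real_of_int k)) \<partial>lborel) = 1" for k
  proof -
    have "1 = ennreal (real n) * (\<integral>\<^sup>+s. ennreal (Psi \<rho> (- real_of_int k + real n * s)) \<partial>lborel)"
      using nn_integral_real_affine[of "\<lambda>x. ennreal (Psi \<rho> x)" "real n" "- real_of_int k"] Psi1 assms(2)
      by simp
    also have "\<dots> = (\<integral>\<^sup>+s. ennreal (real n) * ennreal (Psi \<rho> (- real_of_int k + real n * s)) \<partial>lborel)"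
      by (rule nn_integral_cmult[symmetric]) measurable
    finally show ?thesis by (simp add: ennreal_mult Psi_nonneg[OF assms(1)])
  qed
  have col: "(\<integral>\<^sup>+s. kantorovich_kernel \<rho> n s t \<partial>lborel) =
    (\<Sum>k = - int n..int n - 1. indicator {real_of_int k / real n..(real_of_int k + 1) / real n} t)" for t
    unfolding kantorovich_kernel_def
    by (subst nn_integral_sum, measurable, intro sum.cong refl, subst nn_integral_multc, measurable)
      (simp add: scaled)
  have "AE t in lborel. \<forall>k::int. t \<noteq> real_of_int k / real n"
    by (intro AE_all_countable[THEN iffD2] allI AE_lborel_singleton)
  then show ?thesis
    by (rule eventually_mono) (auto simp: col intro!: sum_indicator_grid_le[OF assms(2)])
qed

section \<open>Pointwise domination of the operator by the product kernel\<close>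

lemma grid_cell_subset_cube:
  assumes "n \<ge> 1" "k \<in> grid_indices r n"
  shows "grid_cell r n k \<subseteq> cube r"
  unfolding grid_cell_def cube_def
proof (rule PiE_mono)
  fix j assume "j \<in> {1..r}"
  then have "k j \<in> {- int n..int n - 1}" using assms(2) by (auto simp: grid_indices_def PiE_iff)
  then have "-1 \<le> real_of_int (k j) / real n" "(real_of_int (k j) + 1) / real n \<le> 1"
    using assms(1) by (simp_all add: field_simps)
  then show "{real_of_int (k j) / real n..(real_of_int (k j) + 1) / real n} \<subseteq> {-1..1}" by auto
qed

lemma grid_cell_measurable: "grid_cell r n k \<in> sets (lborel_on {1..r})"
  unfolding grid_cell_def by (intro sets_PiM_I_finite) auto

text \<open>Distributivity: choosing one cell per coordinate is choosing a multi-index. Membership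
  of \<open>y\<close> in the space supplies the extensionality that \<open>grid_cell\<close>
  demands.\<close>

lemma prod_kantorovich_kernel:
  assumes "mono \<rho>" "y \<in> space (lborel_on {1..r})"
  shows "(\<Prod>j\<in>{1..r}. kantorovich_kernel \<rho> n (x j) (y j)) =
    (\<Sum>k\<in>grid_indices r n. ennreal (real n ^ r * Psi_dim \<rho> r (\<lambda>j. real n * x j - real_of_int (k j))) *
      indicator (grid_cell r n k) y)"
proof -
  have "(\<Prod>j\<in>{1..r}. ennreal (real n * Psi \<rho> (real n * x j - real_of_int (k j))) *
      indicator {real_of_int (k j) / real n..(real_of_int (k j) + 1) / real n} (y j)) =
    ennreal (real n ^ r * Psi_dim \<rho> r (\<lambda>j. real n * x j - real_of_int (k j))) *
      indicator (grid_cell r n k) y" for k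
  proof -
    have "(\<Prod>j\<in>{1..r}. indicator {real_of_int (k j) / real n..(real_of_int (k j) + 1) / real n} (y j))
      = (indicator (grid_cell r n k) y :: ennreal)"
    proof (cases "y \<in> grid_cell r n k")
      case True
      then show ?thesis by (auto simp: grid_cell_def PiE_iff intro!: prod.neutral)
    next
      case False
      then obtain j where "j \<in> {1..r}"
        "y j \<notin> {real_of_int (k j) / real n..(real_of_int (k j) + 1) / real n}"
        using assms(2) by (auto simp: grid_cell_def PiE_iff space_PiM)
      then show ?thesis using False
        by (auto simp: prod_zero_iff intro!: bexI[of _ j])
    qed
    then show ?thesis
      using Psi_nonneg[OF assms(1)]
      by (simp add: prod.distrib prod_ennreal Psi_dim_def)
  qed
  then show ?thesis
    unfolding kantorovich_kernel_def grid_indices_def by (subst prod_sum_PiE) auto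
qed

text \<open>If \<open>f\<close> is not integrable on \<open>A\<close>, the Bochner integral takes
  the default value 0 and the bound is trivial.\<close>

lemma abs_set_lebesgue_integral_le_nn_integral:
  fixes f :: "'a \<Rightarrow> real"
  shows "ennreal \<bar>LINT t:A|completion M. f t\<bar> \<le> (\<integral>\<^sup>+t\<in>A. ennreal \<bar>f t\<bar> \<partial>M)"
proof (cases "set_integrable (completion M) A f")
  case True
  then have "ennreal \<bar>LINT t:A|completion M. f t\<bar>
    \<le> (\<integral>\<^sup>+t. norm (indicator A t *\<^sub>R f t) \<partial>completion M)"
    unfolding set_lebesgue_integral_def set_integrable_def
    using integral_norm_bound_ennreal by fastforce
  also have "\<dots> = (\<integral>\<^sup>+t\<in>A. ennreal \<bar>f t\<bar> \<partial>M)"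
    by (simp add: nn_integral_completion, intro nn_integral_cong) (auto simp: indicator_def)
  finally show ?thesis .
next
  case False
  then show ?thesis
    by (simp add: set_lebesgue_integral_def set_integrable_def not_integrable_integral_eq)
qed

text \<open>By distributivity the denominator is a product of \<open>r\<close> one-dimensional sums,
  each bounded by \<open>lower\<close>.\<close>

lemma kantorovich_denominator_ge:
  assumes "Psi \<rho> 2 > 0" "x \<in> cube r"
    and lower: "\<And>x. x \<in> {-1..1} \<Longrightarrow>
      (\<Sum>k = - int n..int n - 1. Psi \<rho> (real n * x - real_of_int k)) \<ge> Psi \<rho> 2"
  shows "Psi \<rho> 2 ^ r \<le> (\<Sum>k\<in>grid_indices r n. Psi_dim \<rho> r (\<lambda>j. real n * x j - real_of_int (k j)))"
proof -
  have "Psi \<rho> 2 ^ r = (\<Prod>j\<in>{1..r}. Psi \<rho> 2)" by simp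
  also have "\<dots> \<le> (\<Prod>j\<in>{1..r}. \<Sum>k = - int n..int n - 1. Psi \<rho> (real n * x j - real_of_int k))"
    using assms(1,2) lower by (intro prod_mono) (auto simp: cube_def PiE_iff)
  also have "\<dots> = (\<Sum>k\<in>grid_indices r n. Psi_dim \<rho> r (\<lambda>j. real n * x j - real_of_int (k j)))"
    unfolding grid_indices_def Psi_dim_def by (rule prod_sum_PiE) auto
  finally show ?thesis .
qed

text \<open>The operator keeps \<open>f\<close>, while the dominating average uses the Borel
  function \<open>g\<close>, to which Tonelli applies.\<close>

lemma kantorovich_op_le_kernel:
  assumes "mono \<rho>" "Psi \<rho> 2 > 0" "x \<in> cube r" "n \<ge> 1" "lam > 0"
    and lower: "\<And>x. x \<in> {-1..1} \<Longrightarrow>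
      (\<Sum>k = - int n..int n - 1. Psi \<rho> (real n * x - real_of_int k)) \<ge> Psi \<rho> 2"
    and g [measurable]: "g \<in> borel_measurable (lborel_on {1..r})"
    and fg: "AE x in lborel_on {1..r}. x \<in> cube r \<longrightarrow> f x = g x"
  shows "ennreal \<bar>lam * kantorovich_op \<rho> r n f x\<bar> \<le>
    (\<integral>\<^sup>+y. (\<Prod>j\<in>{1..r}. kantorovich_kernel \<rho> n (x j) (y j)) * ennreal \<bar>lam / Psi \<rho> 2 ^ r * g y\<bar>
      \<partial>lborel_on {1..r})"
proof -
  let ?K = "grid_indices r n" and ?M = "lborel_on {1..r}" and ?lam' = "lam / Psi \<rho> 2 ^ r"
  define P where "P k = Psi_dim \<rho> r (\<lambda>j. real n * x j - real_of_int (k j))" for k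
  define a where "a k = (LINT t:grid_cell r n k|lebesgue_dim r. f t)" for k
  have [measurable]: "grid_cell r n k \<in> sets ?M" for k by (rule grid_cell_measurable)
  have P: "P k \<ge> 0" for k
    unfolding P_def Psi_dim_def by (intro prod_nonneg) (auto simp: Psi_nonneg[OF assms(1)])
  have lam': "?lam' > 0" using assms by simp
  have D: "Psi \<rho> 2 ^ r \<le> sum P ?K"
    unfolding P_def by (rule kantorovich_denominator_ge[OF assms(2,3) lower])
  have pos: "0 < Psi \<rho> 2 ^ r" using assms(2) by simp
  \<comment> \<open>Cells lie in the cube, where \<open>f\<close> and \<open>g\<close> agree almost
    everywhere.\<close>
  have a: "ennreal \<bar>a k\<bar> \<le> (\<integral>\<^sup>+y\<in>grid_cell r n k. ennreal \<bar>g y\<bar> \<partial>?M)" if "k \<in> ?K" for k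
  proof -
    have "ennreal \<bar>a k\<bar> \<le> (\<integral>\<^sup>+y\<in>grid_cell r n k. ennreal \<bar>f y\<bar> \<partial>?M)"
      unfolding a_def lebesgue_dim_def by (rule abs_set_lebesgue_integral_le_nn_integral)
    also have "\<dots> \<le> (\<integral>\<^sup>+y\<in>grid_cell r n k. ennreal \<bar>g y\<bar> \<partial>?M)"
      using grid_cell_subset_cube[OF assms(4) that] fg
      by (intro nn_integral_mono_AE) (auto elim!: eventually_mono simp: indicator_def)
    finally show ?thesis .
  qed
  have "\<bar>lam * kantorovich_op \<rho> r n f x\<bar> = lam * \<bar>\<Sum>k\<in>?K. real n ^ r * a k * P k\<bar> / sum P ?K"
    using assms(5) D pos unfolding kantorovich_op_def a_def P_def by (simp add: abs_mult abs_divide)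
  \<comment> \<open>Bounding the denominator from below produces the factor
    \<open>1 / Psi \<rho> 2 ^ r\<close> of \<open>?lam'\<close>.\<close>
  also have "\<dots> \<le> lam * (\<Sum>k\<in>?K. real n ^ r * \<bar>a k\<bar> * P k) / Psi \<rho> 2 ^ r"
  proof (intro frac_le mult_left_mono)
    show "\<bar>\<Sum>k\<in>?K. real n ^ r * a k * P k\<bar> \<le> (\<Sum>k\<in>?K. real n ^ r * \<bar>a k\<bar> * P k)"
      using sum_abs[of "\<lambda>k. real n ^ r * a k * P k" ?K] P by (simp add: abs_mult)
  qed (use assms(5) P D pos in \<open>auto intro!: mult_nonneg_nonneg sum_nonneg\<close>)
  also have "\<dots> = (\<Sum>k\<in>?K. real n ^ r * P k * (?lam' * \<bar>a k\<bar>))"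
    by (simp add: sum_distrib_left sum_divide_distrib mult_ac)
  finally have "ennreal \<bar>lam * kantorovich_op \<rho> r n f x\<bar> \<le>
    ennreal (\<Sum>k\<in>?K. real n ^ r * P k * (?lam' * \<bar>a k\<bar>))"
    by (rule ennreal_leI)
  also have "\<dots> = (\<Sum>k\<in>?K. ennreal (real n ^ r * P k) * (ennreal ?lam' * ennreal \<bar>a k\<bar>))"
  proof (subst sum_ennreal[symmetric])
    show "0 \<le> real n ^ r * P k * (?lam' * \<bar>a k\<bar>)" for k
      using P lam' by (intro mult_nonneg_nonneg) auto
    show "(\<Sum>k\<in>?K. ennreal (real n ^ r * P k * (?lam' * \<bar>a k\<bar>))) =
        (\<Sum>k\<in>?K. ennreal (real n ^ r * P k) * (ennreal ?lam' * ennreal \<bar>a k\<bar>))"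
      using P lam' by (intro sum.cong refl) (simp only: ennreal_mult mult_nonneg_nonneg abs_ge_zero
        less_imp_le zero_le_power of_nat_0_le_iff)
  qed
  also have "\<dots> \<le> (\<Sum>k\<in>?K. ennreal (real n ^ r * P k) *
      (ennreal ?lam' * (\<integral>\<^sup>+y\<in>grid_cell r n k. ennreal \<bar>g y\<bar> \<partial>?M)))"
    by (intro sum_mono mult_left_mono a) auto
  also have "\<dots> = (\<Sum>k\<in>?K. \<integral>\<^sup>+y. ennreal (real n ^ r * P k) *
      (ennreal ?lam' * (ennreal \<bar>g y\<bar> * indicator (grid_cell r n k) y)) \<partial>?M)"
    by (intro sum.cong refl, (subst nn_integral_cmult, measurable)+)
  also have "\<dots> = (\<integral>\<^sup>+y. (\<Sum>k\<in>?K. ennreal (real n ^ r * P k) *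
      (ennreal ?lam' * (ennreal \<bar>g y\<bar> * indicator (grid_cell r n k) y))) \<partial>?M)"
    by (rule nn_integral_sum[symmetric]) measurable
  also have "\<dots> = (\<integral>\<^sup>+y. (\<Prod>j\<in>{1..r}. kantorovich_kernel \<rho> n (x j) (y j)) * ennreal \<bar>?lam' * g y\<bar> \<partial>?M)"
  proof (rule nn_integral_cong)
    fix y assume y: "y \<in> space ?M"
    have "ennreal \<bar>?lam' * g y\<bar> = ennreal ?lam' * ennreal \<bar>g y\<bar>"
      using lam' by (simp only: abs_mult abs_of_pos ennreal_mult abs_ge_zero less_imp_le)
    then show "(\<Sum>k\<in>?K. ennreal (real n ^ r * P k) *
      (ennreal ?lam' * (ennreal \<bar>g y\<bar> * indicator (grid_cell r n k) y))) =
      (\<Prod>j\<in>{1..r}. kantorovich_kernel \<rho> n (x j) (y j)) * ennreal \<bar>?lam' * g y\<bar>"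
      unfolding prod_kantorovich_kernel[OF assms(1) y] P_def sum_distrib_right
      by (simp only: mult_ac)
  qed
  finally show ?thesis .
qed

section \<open>Borel representatives and the modular inequality\<close>

text \<open>Extended by 0 off the cube, \<open>f\<close> is measurable for the completed measure,
  hence almost everywhere equal to a Borel function.\<close>

lemma measurable_on_cube_borel_representative:
  assumes "f \<in> measurable_on_cube r"
  obtains g where "g \<in> borel_measurable (lborel_on {1..r})"
    "AE x in lborel_on {1..r}. x \<in> cube r \<longrightarrow> f x = g x"
proof -
  have "cube r \<in> sets (lborel_on {1..r})"
    unfolding cube_def by (intro sets_PiM_I_finite) auto
  then have "cube r \<inter> space (lebesgue_dim r) \<in> sets (lebesgue_dim r)"
    unfolding lebesgue_dim_def by (intro sets.Int) (auto intro: sets_completionI_sets)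
  then have "(\<lambda>x. indicator (cube r) x *\<^sub>R f x) \<in> borel_measurable (completion (lborel_on {1..r}))"
    using assms borel_measurable_restrict_space_iff[of "cube r" "lebesgue_dim r" f]
    unfolding measurable_on_cube_def lebesgue_dim_def by simp
  then obtain g where "g \<in> borel_measurable (lborel_on {1..r})"
    "AE x in lborel_on {1..r}. indicator (cube r) x *\<^sub>R f x = g x"
    using completion_ex_borel_measurable_real by blast
  then show thesis
    by (intro that[of g]) (auto elim!: eventually_mono simp: indicator_def)
qed

theorem theorem4p1:
  fixes \<rho> :: "real \<Rightarrow> real"
    and r n :: nat
    and \<Phi> :: "nat \<Rightarrow> real \<Rightarrow> ennreal"
    and lam :: real
    and f :: "(nat \<Rightarrow> real) \<Rightarrow> real"
  assumes "mono \<rho>"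
    and "sigmoidal \<rho>"
    and "\<exists>\<eta>>1. Psi \<rho> \<in> O[at_infinity](\<lambda>x. \<bar>x\<bar> powr (- \<eta>))"
    and "has_bochner_integral lebesgue (Psi \<rho>) 1"
    and "\<And>x. ((\<lambda>k::int. Psi \<rho> (x - real_of_int k)) has_sum 1) UNIV"
    and "\<And>C. compact C \<Longrightarrow>
           uniform_limit C (\<lambda>F x. \<Sum>k\<in>F. Psi \<rho> (x - real_of_int k)) (\<lambda>_. 1)
             (finite_subsets_at_top (UNIV :: int set))"
    and "\<And>(m::nat) x. m \<ge> 1 \<Longrightarrow> x \<in> {-1..1} \<Longrightarrow>
           (\<Sum>k = - int m..int m - 1. Psi \<rho> (real m * x - real_of_int k)) \<ge> Psi \<rho> 2"
    and "Psi \<rho> 2 > 0"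
    and "r \<ge> 1"
    and "\<And>j. j \<in> {1..r} \<Longrightarrow> orlicz_function (\<Phi> j)"
    and "lam > 0"
    and "f \<in> mixed_orlicz_space r \<Phi>"
    and "n \<ge> 1"
  shows "lam / Psi \<rho> 2 ^ r > 0 \<and>
         mixed_modular r \<Phi> (\<lambda>x. lam * kantorovich_op \<rho> r n f x)
           \<le> mixed_modular r \<Phi> (\<lambda>x. (lam / Psi \<rho> 2 ^ r) * f x)"
proof
  show "lam / Psi \<rho> 2 ^ r > 0" using assms by simp
  have "f \<in> measurable_on_cube r" using assms(12) by (simp add: mixed_orlicz_space_def)
  then obtain g where g [measurable]: "g \<in> borel_measurable (lborel_on {1..r})"
    and fg: "AE x in lborel_on {1..r}. x \<in> cube r \<longrightarrow> f x = g x"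
    by (rule measurable_on_cube_borel_representative)
  let ?F = "\<lambda>x. ennreal \<bar>lam * kantorovich_op \<rho> r n f x\<bar>"
  let ?G = "\<lambda>x. ennreal \<bar>lam / Psi \<rho> 2 ^ r * g x\<bar>"
  have "nn_modular \<Phi> ?F r (\<lambda>_. undefined) \<le> nn_modular \<Phi> ?G r (\<lambda>_. undefined)"
  proof (rule nn_modular_kernel_le_cube[where \<kappa> = "kantorovich_kernel \<rho> n"])
    show "?G \<in> borel_measurable (lborel_on {1..r})" by measurable
    show "?F x \<le> (\<integral>\<^sup>+y. (\<Prod>j\<in>{1..r}. kantorovich_kernel \<rho> n (x j) (y j)) * ?G y \<partial>lborel_on {1..r})"
      if "x \<in> cube r" for x
      using kantorovich_op_le_kernel[OF assms(1,8) that assms(13,11) assms(7)[OF assms(13)] g fg] .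
  qed (use assms in \<open>auto intro!: kantorovich_kernel_measurable kantorovich_kernel_row kantorovich_kernel_column\<close>)
  \<comment> \<open>Sections of \<open>f\<close> may fail to be measurable, so the return from
    \<open>g\<close> to \<open>f\<close> goes through almost everywhere monotonicity.\<close>
  also have "\<dots> \<le> nn_modular \<Phi> (\<lambda>x. ennreal \<bar>lam / Psi \<rho> 2 ^ r * f x\<bar>) r (\<lambda>_. undefined)"
    using fg by (intro nn_modular_mono_AE_cube assms(10)) (auto elim!: eventually_mono)
  finally show "mixed_modular r \<Phi> (\<lambda>x. lam * kantorovich_op \<rho> r n f x)
      \<le> mixed_modular r \<Phi> (\<lambda>x. (lam / Psi \<rho> 2 ^ r) * f x)"
    unfolding mixed_modular_def partial_modular_eq_nn_modular .
qed

end
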